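(* Let $T>R>P>S$ be real numbers with $2R>T+S$. Assume X eventually plays a convex-generous Smale plan and Y plays a generous Markov plan. With probability one there is a time after which both players play $c$, and so $\lim_{N\to\infty}s^N=(R,R)$.
   Context: Iterated Prisoner's Dilemma. In each round $n=1,2,\dots$ players X and Y choose $c$ or $d$ (independently given the past). Outcomes are written with X's choice first; outcomes $cc,cd,dc,dd$ give the payoff pairs $S^n=(S^n_X,S^n_Y)=(R,R),(S,T),(T,S),(P,P)$ respectively. Let $\mathcal{S}\subset\mathbb{R}^2$ be the convex hull of these four points and $s^N=\frac1N\sum_{n=1}^N S^n\in\mathcal{S}$. The initial plays (round 1) are arbitrary. A Smale plan is a function $\pi:\mathcal{S}\to[0,1]$; if X uses $\pi$ then in round $N+1$ X plays $c$ with probability $\pi(s^N)$. X eventually plays $\pi$ if there is $N^*$ such that X uses $\pi$ in round $N+1$ for all $N\ge N^*$; X's earlier play is arbitrary. A Smale plan $\pi$ is convex-generous if $\pi$ takes values in $\{0,1\}$ and the cooperation zone $C=\pi^{-1}(1)$ is a closed convex set such that (i) $(P,P),(R,R),(T,S)\in C$; (ii) $(S,T)\notin C$; (iii) $\left(\tfrac12(T+S),\tfrac12(T+S)\right)\in C^{\circ}$, where $C^\circ$ is the interior of $C$ relative to $\mathcal{S}$. A Markov plan for Y is a vector $\mathbf{q}=(q_1,q_2,q_3,q_4)\in[0,1]^4$ described from Y's perspective: after the first round Y plays $c$ with probability $q_1,q_3,q_2,q_4$ when the outcome of the previous round (X's choice first) was $cc,cd,dc,dd$ respectively. It is generous when $q_1=1$,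 $0<q_2<1$ and $q_4>0$. *)

theory Defs
  imports "HOL-Probability.Probability"
begin

datatype move = Coop | Defect

(* Arguments (moves of X, Y); result (payoff to X, payoff to Y). *)
fun payoff :: "real \<Rightarrow> real \<Rightarrow> real \<Rightarrow> real \<Rightarrow> move \<times> move \<Rightarrow> real \<times> real" where
  "payoff R S T P (Coop, Coop) = (R, R)"
| "payoff R S T P (Coop, Defect) = (S, T)"
| "payoff R S T P (Defect, Coop) = (T, S)"
| "payoff R S T P (Defect, Defect) = (P, P)"

definition payoff_region :: "real \<Rightarrow> real \<Rightarrow> real \<Rightarrow> real \<Rightarrow> (real \<times> real) set" where
  "payoff_region R S T P = convex hull {(R, R), (S, T), (T, S), (P, P)}"

(* Rounds are numbered from 1; the value of a play at index 0 is never used. *)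
definition avg_payoff ::
    "real \<Rightarrow> real \<Rightarrow> real \<Rightarrow> real \<Rightarrow> (nat \<Rightarrow> move \<times> move) \<Rightarrow> nat \<Rightarrow> real \<times> real" where
  "avg_payoff R S T P g N = (1 / real N) *\<^sub>R (\<Sum>n = 1..N. payoff R S T P (g n))"

(* X n and Y n are the random moves in round n. In each round the two moves are independent
   conditionally on the outcomes of all earlier rounds; this is the only restriction, so
   the players may use any history-dependent randomised play. For a history g of probability
   zero all conditional probabilities are 0 by convention and the equation is trivial. *)
locale iterated_game = prob_space M for M :: "'w measure" +
  fixes X Y :: "nat \<Rightarrow> 'w \<Rightarrow> move"
  assumes X_measurable: "\<And>n. n \<ge> 1 \<Longrightarrow> X n \<in> measurable M (count_space UNIV)"
    and Y_measurable: "\<And>n. n \<ge> 1 \<Longrightarrow> Y n \<in> measurable M (count_space UNIV)"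
    and indep_given_past: "\<And>N g a b.
      \<P>(\<omega> in M. X (Suc N) \<omega> = a \<and> Y (Suc N) \<omega> = b \<bar> \<forall>n\<in>{1..N}. (X n \<omega>, Y n \<omega>) = g n) =
      \<P>(\<omega> in M. X (Suc N) \<omega> = a \<bar> \<forall>n\<in>{1..N}. (X n \<omega>, Y n \<omega>) = g n) *
      \<P>(\<omega> in M. Y (Suc N) \<omega> = b \<bar> \<forall>n\<in>{1..N}. (X n \<omega>, Y n \<omega>) = g n)"

(* Given the outcomes of rounds 1..N, the player whose moves are Z cooperates in round N + 1
   with probability f g, for every possible history g (only g 1, ..., g N matter). *)
definition coop_prob_given_past ::
    "'w measure \<Rightarrow> (nat \<Rightarrow> 'w \<Rightarrow> move) \<Rightarrow> (nat \<Rightarrow> 'w \<Rightarrow> move) \<Rightarrow> (nat \<Rightarrow> 'w \<Rightarrow> move) \<Rightarrow>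
      nat \<Rightarrow> ((nat \<Rightarrow> move \<times> move) \<Rightarrow> real) \<Rightarrow> bool" where
  "coop_prob_given_past M X Y Z N f \<longleftrightarrow>
    (\<forall>g. \<P>(\<omega> in M. \<forall>n\<in>{1..N}. (X n \<omega>, Y n \<omega>) = g n) > 0 \<longrightarrow>
      \<P>(\<omega> in M. Z (Suc N) \<omega> = Coop \<bar> \<forall>n\<in>{1..N}. (X n \<omega>, Y n \<omega>) = g n) = f g)"

(* A plan is a function on the payoff region; its values elsewhere are irrelevant. *)
definition smale_plan ::
    "real \<Rightarrow> real \<Rightarrow> real \<Rightarrow> real \<Rightarrow> (real \<times> real \<Rightarrow> real) \<Rightarrow> bool" where
  "smale_plan R S T P \<pi> \<longleftrightarrow> (\<forall>s \<in> payoff_region R S T P. 0 \<le> \<pi> s \<and> \<pi> s \<le> 1)"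

definition coop_zone ::
    "real \<Rightarrow> real \<Rightarrow> real \<Rightarrow> real \<Rightarrow> (real \<times> real \<Rightarrow> real) \<Rightarrow> (real \<times> real) set" where
  "coop_zone R S T P \<pi> = {s \<in> payoff_region R S T P. \<pi> s = 1}"

definition convex_generous ::
    "real \<Rightarrow> real \<Rightarrow> real \<Rightarrow> real \<Rightarrow> (real \<times> real \<Rightarrow> real) \<Rightarrow> bool" where
  "convex_generous R S T P \<pi> \<longleftrightarrow>
    smale_plan R S T P \<pi> \<and>
    (\<forall>s \<in> payoff_region R S T P. \<pi> s \<in> {0, 1}) \<and>
    closed (coop_zone R S T P \<pi>) \<and> convex (coop_zone R S T P \<pi>) \<and>
    {(P, P), (R, R), (T, S)} \<subseteq> coop_zone R S T P \<pi> \<and>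
    (S, T) \<notin> coop_zone R S T P \<pi> \<and>
    ((T + S) / 2, (T + S) / 2) \<in>
      top_of_set (payoff_region R S T P) interior_of coop_zone R S T P \<pi>"

(* The average payoff is undefined before round 1, hence Nstar \<ge> 1. *)
definition eventually_plays_smale ::
    "real \<Rightarrow> real \<Rightarrow> real \<Rightarrow> real \<Rightarrow> 'w measure \<Rightarrow> (nat \<Rightarrow> 'w \<Rightarrow> move) \<Rightarrow> (nat \<Rightarrow> 'w \<Rightarrow> move) \<Rightarrow>
      (real \<times> real \<Rightarrow> real) \<Rightarrow> bool" where
  "eventually_plays_smale R S T P M X Y \<pi> \<longleftrightarrow>
    (\<exists>Nstar\<ge>1. \<forall>N\<ge>Nstar.
      coop_prob_given_past M X Y X N (\<lambda>g. \<pi> (avg_payoff R S T P g N)))"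

definition markov_plan :: "real^4 \<Rightarrow> bool" where
  "markov_plan q \<longleftrightarrow> (\<forall>i. 0 \<le> q $ i \<and> q $ i \<le> 1)"

(* Outcomes list X's move first, whereas the components of q are ordered from the point of view
   of Y: this is why the indices 2 and 3 are interchanged. *)
fun markov_response :: "real^4 \<Rightarrow> move \<times> move \<Rightarrow> real" where
  "markov_response q (Coop, Coop) = q $ 1"
| "markov_response q (Coop, Defect) = q $ 3"
| "markov_response q (Defect, Coop) = q $ 2"
| "markov_response q (Defect, Defect) = q $ 4"

definition generous_markov :: "real^4 \<Rightarrow> bool" where
  "generous_markov q \<longleftrightarrow> markov_plan q \<and> q $ 1 = 1 \<and> 0 < q $ 2 \<and> q $ 2 < 1 \<and> q $ 4 > 0"

definition plays_markov ::
    "'w measure \<Rightarrow> (nat \<Rightarrow> 'w \<Rightarrow> move) \<Rightarrow> (nat \<Rightarrow> 'w \<Rightarrow> move) \<Rightarrow> real^4 \<Rightarrow> bool" where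
  "plays_markov M X Y q \<longleftrightarrow>
    (\<forall>N\<ge>1. coop_prob_given_past M X Y Y N (\<lambda>g. markov_response q (g N)))"

end

theory Submission imports Defs begin

text \<open>
Write \<open>C\<close> for the cooperation zone and \<open>s n\<close> for the average payoff after \<open>n\<close> rounds.
The proof splits into a deterministic statement about a single play and two almost sure
statements about how Y responds.

Once X follows the plan, mutual cooperation is absorbing: in such a round the previous average
lies in the convex set \<open>C\<close>, mixing in \<open>(R, R)\<close> keeps it there, so X cooperates
again, and so does Y because a generous plan answers mutual cooperation by cooperation
(\<open>mutual_cooperation_absorbing\<close>). It remains to exclude plays in which mutual cooperation
never happens after X has started to follow the plan. There are three ways in which X can behave.

\<^item> X cooperates from some time on. Y then always defects, so the averages, which now lie
  in the closed set \<open>C\<close>, converge to \<open>(S, T)\<close>, which is not in \<open>C\<close>.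

\<^item> X defects from some time on. After a defection of X, Y cooperates with probability at least
  \<open>p = min q2 q4 > 0\<close>, so almost surely the outcome \<open>dc\<close> occurs infinitely often,
  while \<open>cd\<close> occurs only finitely often. As soon as \<open>dc\<close> is at least as frequent
  as \<open>cd\<close>, every \<open>cd\<close> can be paired with a \<open>dc\<close>; the pair contributes
  the point \<open>((T + S) / 2, (T + S) / 2)\<close> of \<open>C\<close>, and the unpaired outcomes
  contribute \<open>(R, R)\<close>, \<open>(T, S)\<close> and \<open>(P, P)\<close>. So \<open>s n\<close> is in
  \<open>C\<close> by convexity (\<open>avg_payoff_in_coop_zone\<close>), and X cooperates after all.

\<^item> X switches from defection to cooperation infinitely often. At each switch Y cooperates with
  probability at least \<open>p\<close>, so almost surely it does so at some late switch, and that
  round is one of mutual cooperation.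

Both almost sure statements are instances of a conditional second Borel-Cantelli lemma
(\<open>AE_infinitely_many_successes\<close>): opportunities that are recognisable from the past and
succeed with conditional probability at least \<open>p\<close> cannot recur forever with only
finitely many successes.
\<close>

section \<open>Average payoffs\<close>

lemma UNIV_outcomes:
  "(UNIV :: (move \<times> move) set) =
    {(Coop, Coop), (Coop, Defect), (Defect, Coop), (Defect, Defect)}"
proof -
  have "x = Coop \<or> x = Defect" for x by (cases x) auto
  then show ?thesis by auto
qed

lemma finite_outcomes: "finite (UNIV :: (move \<times> move) set)"
  by (simp add: UNIV_outcomes)

definition freq :: "(nat \<Rightarrow> move \<times> move) \<Rightarrow> nat \<Rightarrow> move \<times> move \<Rightarrow> real" where
  "freq g N z = card {n \<in> {1..N}. g n = z} / N"

lemma freq_nonneg: "0 \<le> freq g N z"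
  by (simp add: freq_def)

lemma sum_freq:
  assumes "N \<ge> 1"
  shows "(\<Sum>z\<in>UNIV. freq g N z) = 1"
proof -
  have "(\<Sum>z\<in>UNIV. \<Sum>n\<in>{n \<in> {1..N}. g n = z}. (1::real)) = (\<Sum>n\<in>{1..N}. 1)"
    by (rule sum.group) (auto simp: finite_outcomes)
  then show ?thesis
    using assms by (simp add: freq_def flip: sum_divide_distrib)
qed

lemma avg_payoff_eq_freq:
  "avg_payoff R S T P g N = (\<Sum>z\<in>UNIV. freq g N z *\<^sub>R payoff R S T P z)"
proof -
  have "(\<Sum>n\<in>{1..N}. payoff R S T P (g n))
      = (\<Sum>z\<in>UNIV. \<Sum>n\<in>{n \<in> {1..N}. g n = z}. payoff R S T P (g n))"
    by (rule sum.group[symmetric]) (auto simp: finite_outcomes)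
  also have "\<dots> = (\<Sum>z\<in>UNIV. real (card {n \<in> {1..N}. g n = z}) *\<^sub>R payoff R S T P z)"
    by (intro sum.cong refl) (simp add: sum_constant_scaleR)
  finally show ?thesis
    by (simp add: avg_payoff_def freq_def scaleR_right.sum)
qed

lemma avg_payoff_in_region:
  assumes "N \<ge> 1"
  shows "avg_payoff R S T P g N \<in> payoff_region R S T P"
  unfolding avg_payoff_eq_freq
proof (rule convex_sum)
  fix z :: "move \<times> move"
  have "payoff R S T P z \<in> {(R, R), (S, T), (T, S), (P, P)}"
    by (cases z; cases "fst z"; cases "snd z") auto
  then show "payoff R S T P z \<in> payoff_region R S T P"
    unfolding payoff_region_def by (rule hull_inc)
qed (auto simp: finite_outcomes sum_freq[OF assms] freq_nonneg payoff_region_def)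

lemma avg_payoff_Suc:
  "avg_payoff R S T P g (Suc N) =
    (N / Suc N) *\<^sub>R avg_payoff R S T P g N + (1 / Suc N) *\<^sub>R payoff R S T P (g (Suc N))"
  by (simp add: avg_payoff_def scaleR_right_distrib del: of_nat_Suc)

lemma avg_payoff_cong:
  assumes "\<And>n. n \<in> {1..N} \<Longrightarrow> g n = g' n"
  shows "avg_payoff R S T P g N = avg_payoff R S T P g' N"
  by (simp add: avg_payoff_def assms)

lemma avg_payoff_eventually_const:
  assumes "\<And>n. n \<ge> N0 \<Longrightarrow> g n = z"
  shows "avg_payoff R S T P g \<longlonglongrightarrow> payoff R S T P z"
proof -
  define a where "a = (\<Sum>n = 1..N0. payoff R S T P (g n))"
  have eq: "avg_payoff R S T P g N
      = (1 / real N) *\<^sub>R a + (1 - real N0 / real N) *\<^sub>R payoff R S T P z"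
    if "N \<ge> Suc N0" for N
  proof -
    have "{1..N} = {1..N0} \<union> {Suc N0..N}" using that by auto
    then have "(\<Sum>n = 1..N. payoff R S T P (g n)) = a + (\<Sum>n = Suc N0..N. payoff R S T P (g n))"
      by (simp add: a_def sum.union_disjoint)
    also have "(\<Sum>n = Suc N0..N. payoff R S T P (g n)) = real (N - N0) *\<^sub>R payoff R S T P z"
      using that by (simp add: assms sum_constant_scaleR)
    finally show ?thesis
      using that by (simp add: avg_payoff_def scaleR_right_distrib of_nat_diff diff_divide_distrib)
  qed
  have "(\<lambda>N. (1 / real N) *\<^sub>R a + (1 - real N0 / real N) *\<^sub>R payoff R S T P z)
      \<longlonglongrightarrow> 0 *\<^sub>R a + (1 - 0) *\<^sub>R payoff R S T P z"
    by (intro tendsto_intros lim_const_over_n)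
  moreover have "\<forall>\<^sub>F N in sequentially.
      (1 / real N) *\<^sub>R a + (1 - real N0 / real N) *\<^sub>R payoff R S T P z = avg_payoff R S T P g N"
    using eventually_ge_at_top[of "Suc N0"] by eventually_elim (simp only: eq)
  ultimately have "avg_payoff R S T P g \<longlonglongrightarrow> 0 *\<^sub>R a + (1 - 0) *\<^sub>R payoff R S T P z"
    by (rule Lim_transform_eventually)
  then show ?thesis by simp
qed

section \<open>Convex-generous zones along one play\<close>

text \<open>Each play of \<open>cd\<close> is paired with a play of \<open>dc\<close>. The average is thus
rewritten as a convex combination in which the payoff \<open>(S, T)\<close>, the only one outside the
zone, is replaced by the midpoint of \<open>(S, T)\<close> and \<open>(T, S)\<close>.\<close>

lemma avg_payoff_in_coop_zone:
  assumes gen: "convex_generous R S T P \<pi>" and "N \<ge> 1"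
    and le: "freq g N (Coop, Defect) \<le> freq g N (Defect, Coop)"
  shows "avg_payoff R S T P g N \<in> coop_zone R S T P \<pi>"
proof -
  let ?C = "coop_zone R S T P \<pi>" and ?m = "((T + S) / 2, (T + S) / 2)"
  define w where "w = (freq g N)((Coop, Defect) := 2 * freq g N (Coop, Defect),
    (Defect, Coop) := freq g N (Defect, Coop) - freq g N (Coop, Defect))"
  define y where "y = (payoff R S T P)((Coop, Defect) := ?m)"
  have "?m \<in> ?C"
    using gen interior_of_subset[of "top_of_set (payoff_region R S T P)" ?C]
    unfolding convex_generous_def by blast
  then have y: "y z \<in> ?C" for z
    using gen UNIV_I[of z] unfolding UNIV_outcomes convex_generous_def y_def by auto
  have w: "0 \<le> w z" for z
    using le by (auto simp: w_def freq_nonneg)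
  have sum_w: "(\<Sum>z\<in>UNIV. w z) = 1"
    using sum_freq[OF \<open>N \<ge> 1\<close>, of g] by (simp add: UNIV_outcomes w_def)
  have "(\<Sum>z\<in>UNIV. w z *\<^sub>R y z) \<in> ?C"
    using gen w y sum_w finite_outcomes by (intro convex_sum) (auto simp: convex_generous_def)
  also have "(\<Sum>z\<in>UNIV. w z *\<^sub>R y z) = avg_payoff R S T P g N"
    by (simp add: avg_payoff_eq_freq UNIV_outcomes w_def y_def field_simps)
  finally show ?thesis .
qed

text \<open>The induction has to carry along that the average stays in the zone: this is what makes
X cooperate in the next round.\<close>

lemma mutual_cooperation_absorbing:
  assumes gen: "convex_generous R S T P \<pi>"
    and X: "\<And>n. n \<ge> N0 \<Longrightarrow> avg_payoff R S T P g n \<in> coop_zone R S T P \<pi> \<Longrightarrow>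
      fst (g (Suc n)) = Coop"
    and Y: "\<And>n. n \<ge> N0 \<Longrightarrow> g n = (Coop, Coop) \<Longrightarrow> snd (g (Suc n)) = Coop"
    and start: "k \<ge> N0" "g (Suc k) = (Coop, Coop)"
      "avg_payoff R S T P g k \<in> coop_zone R S T P \<pi>"
    and "n \<ge> Suc k"
  shows "g n = (Coop, Coop)"
proof -
  let ?C = "coop_zone R S T P \<pi>"
  have stays: "avg_payoff R S T P g (Suc n) \<in> ?C"
    if "avg_payoff R S T P g n \<in> ?C" "g (Suc n) = (Coop, Coop)" for n
  proof -
    have "convex ?C" "(R, R) \<in> ?C" using gen by (auto simp: convex_generous_def)
    moreover have "real n / Suc n + 1 / Suc n = 1" by (simp add: field_simps)
    ultimately show ?thesis
      unfolding avg_payoff_Suc using that by (intro convexD) auto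
  qed
  from \<open>n \<ge> Suc k\<close> have "g n = (Coop, Coop) \<and> avg_payoff R S T P g n \<in> ?C"
  proof (induction n rule: dec_induct)
    case base
    then show ?case using start stays by blast
  next
    case (step n)
    then have "g (Suc n) = (Coop, Coop)"
      using X[of n] Y[of n] \<open>k \<ge> N0\<close> by (simp add: prod_eq_iff)
    then show ?case using step stays by blast
  qed
  then show ?thesis by blast
qed

text \<open>The rounds before \<open>k\<close> contain fewer than \<open>k\<close> plays of \<open>cd\<close>, and none
follow, so \<open>k\<close> plays of \<open>dc\<close> suffice to compensate for all of them.\<close>

lemma eventually_enters_coop_zone:
  assumes gen: "convex_generous R S T P \<pi>"
    and D: "\<And>n. n \<ge> k \<Longrightarrow> fst (g n) = Defect"
    and inf: "\<exists>\<^sub>\<infinity>n. g n = (Defect, Coop)"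
  shows "\<exists>n\<ge>k. avg_payoff R S T P g n \<in> coop_zone R S T P \<pi>"
proof -
  have "infinite {n. g n = (Defect, Coop)}"
    using inf by (simp add: INFM_iff_infinite)
  \<comment> \<open>Index 0 is discarded because it is not a round and is not counted by \<open>freq\<close>.\<close>
  then have "infinite ({n. g n = (Defect, Coop)} - {0})" by simp
  then obtain F where F: "F \<subseteq> {n. g n = (Defect, Coop)} - {0}" "finite F" "card F = k"
    by (metis infinite_arbitrarily_large)
  obtain b where "F \<subseteq> {..b}" using F(2) finite_nat_iff_bounded_le by blast
  define N where "N = Suc (b + k)"
  have N: "N \<ge> k" "N \<ge> 1" "F \<subseteq> {1..N}"
    using F(1) \<open>F \<subseteq> {..b}\<close> by (fastforce simp: N_def Suc_le_eq)+
  have "{n \<in> {1..N}. g n = (Coop, Defect)} \<subseteq> {1..<k}"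
    using D by (fastforce simp: not_le[symmetric])
  then have "card {n \<in> {1..N}. g n = (Coop, Defect)} \<le> card {1..<k}"
    by (intro card_mono) auto
  also have "\<dots> \<le> card F" using F by simp
  also have "\<dots> \<le> card {n \<in> {1..N}. g n = (Defect, Coop)}"
    using N F by (intro card_mono) auto
  finally have "freq g N (Coop, Defect) \<le> freq g N (Defect, Coop)"
    by (simp add: freq_def divide_right_mono)
  then show ?thesis
    using avg_payoff_in_coop_zone[OF gen \<open>N \<ge> 1\<close>] N by blast
qed

text \<open>The deterministic core. The hypotheses \<open>inf_D\<close> and \<open>inf_switch\<close> are the two
instances of the conditional Borel-Cantelli lemma; if mutual cooperation failed to set in, the
first would rule out that X defects forever and the second that X switches to cooperation
infinitely often.\<close>

lemma eventual_mutual_cooperation: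
  assumes gen: "convex_generous R S T P \<pi>"
    and X: "\<And>n. n \<ge> N0 \<Longrightarrow>
      fst (g (Suc n)) = Coop \<longleftrightarrow> avg_payoff R S T P g n \<in> coop_zone R S T P \<pi>"
    and Y: "\<And>n. n \<ge> N0 \<Longrightarrow> g n = (Coop, Coop) \<Longrightarrow> snd (g (Suc n)) = Coop"
    and inf_D: "\<exists>\<^sub>\<infinity>n. fst (g n) = Defect \<Longrightarrow>
      \<exists>\<^sub>\<infinity>n. fst (g n) = Defect \<and> snd (g (Suc n)) = Coop"
    and inf_switch:
      "\<exists>\<^sub>\<infinity>n. fst (g n) = Defect \<and> avg_payoff R S T P g n \<in> coop_zone R S T P \<pi> \<Longrightarrow>
      \<exists>\<^sub>\<infinity>n. (fst (g n) = Defect \<and> avg_payoff R S T P g n \<in> coop_zone R S T P \<pi>) \<and>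
        snd (g (Suc n)) = Coop"
  shows "\<exists>N. \<forall>n\<ge>N. g n = (Coop, Coop)"
proof (rule ccontr)
  let ?C = "coop_zone R S T P \<pi>"
  assume never: "\<not> ?thesis"
  have no_cc: "g (Suc n) \<noteq> (Coop, Coop)" if "n \<ge> N0" for n
    using mutual_cooperation_absorbing[OF gen, of N0 g n] X Y never that by (metis fst_conv)
  have "\<not> (\<exists>\<^sub>\<infinity>n. fst (g n) = Defect \<and> avg_payoff R S T P g n \<in> ?C)"
  proof
    assume "\<exists>\<^sub>\<infinity>n. fst (g n) = Defect \<and> avg_payoff R S T P g n \<in> ?C"
    from inf_switch[OF this] obtain n where "n \<ge> N0" "avg_payoff R S T P g n \<in> ?C"
      "snd (g (Suc n)) = Coop"
      unfolding INFM_nat_le by blast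
    then show False using X[of n] no_cc[of n] by (simp add: prod_eq_iff)
  qed
  then obtain m where m: "\<And>n. n \<ge> m \<Longrightarrow> \<not> (fst (g n) = Defect \<and> avg_payoff R S T P g n \<in> ?C)"
    unfolding not_INFM MOST_nat_le by blast
  show False
  proof (cases "\<exists>k \<ge> max m N0. fst (g k) = Defect")
    case True
    then obtain k where k: "k \<ge> max m N0" "fst (g k) = Defect" by blast
    \<comment> \<open>From \<open>max m N0\<close> on, X never switches from defection to cooperation.\<close>
    have D: "fst (g n) = Defect" if "n \<ge> k" for n
      using that
    proof (induction n rule: dec_induct)
      case base
      then show ?case using k by simp
    next
      case (step n)
      then show ?case using m[of n] X[of n] k by (cases "fst (g (Suc n))") auto
    qed
    have "\<exists>\<^sub>\<infinity>n. fst (g n) = Defect"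
      unfolding INFM_nat_le using D by (metis nat_le_linear)
    \<comment> \<open>X still defects in the round after, so a cooperation of Y there gives \<open>dc\<close>.\<close>
    from inf_D[OF this] have "\<exists>\<^sub>\<infinity>n. g n = (Defect, Coop)"
      unfolding INFM_nat_le
    proof (intro allI)
      fix j assume "\<forall>j. \<exists>n\<ge>j. fst (g n) = Defect \<and> snd (g (Suc n)) = Coop"
      then obtain n where "n \<ge> max j k" "snd (g (Suc n)) = Coop" by blast
      then show "\<exists>n\<ge>j. g n = (Defect, Coop)"
        using D[of "Suc n"] by (intro exI[of _ "Suc n"]) (auto simp: prod_eq_iff)
    qed
    from eventually_enters_coop_zone[OF gen D this] obtain n where "n \<ge> k" "avg_payoff R S T P g n \<in> ?C"
      by blast
    then show False using m[of n] D k by auto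
  next
    case False
    have cd: "g n = (Coop, Defect)" if "n \<ge> Suc (max m N0)" for n
    proof -
      obtain n' where n': "n = Suc n'" "n' \<ge> max m N0" using \<open>n \<ge> _\<close> by (metis Suc_le_D Suc_le_mono)
      have "fst (g n) = Coop" using False n' by (cases "fst (g n)") auto
      then show ?thesis using no_cc[of n'] n' by (cases "snd (g n)") (auto simp: prod_eq_iff)
    qed
    have "avg_payoff R S T P g \<longlonglongrightarrow> (S, T)"
      using avg_payoff_eventually_const[OF cd] by simp
    moreover have "eventually (\<lambda>n. avg_payoff R S T P g n \<in> ?C) sequentially"
      unfolding eventually_sequentially
    proof (intro exI allI impI)
      fix n assume "n \<ge> Suc (max m N0)"
      then show "avg_payoff R S T P g n \<in> ?C" using X[of n] cd[of "Suc n"] by simp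
    qed
    ultimately have "(S, T) \<in> ?C"
      using gen by (auto simp: convex_generous_def intro: Lim_in_closed_set)
    then show False using gen by (simp add: convex_generous_def)
  qed
qed

section \<open>Conditioning on the past\<close>

text \<open>Events are predicates on the whole infinite play rather than on lists of outcomes, so that
averages and earlier rounds can be mentioned directly; that only the first \<open>N\<close> rounds
matter becomes a side condition.\<close>

definition past_event :: "nat \<Rightarrow> ((nat \<Rightarrow> move \<times> move) \<Rightarrow> bool) \<Rightarrow> bool" where
  "past_event N A \<longleftrightarrow> (\<forall>g g'. (\<forall>n\<in>{1..N}. g n = g' n) \<longrightarrow> A g = A g')"

context iterated_game
begin

abbreviation play :: "'w \<Rightarrow> nat \<Rightarrow> move \<times> move" where
  "play \<omega> \<equiv> \<lambda>n. (X n \<omega>, Y n \<omega>)"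

abbreviation past_is :: "nat \<Rightarrow> (nat \<Rightarrow> move \<times> move) \<Rightarrow> 'w \<Rightarrow> bool" where
  "past_is N g \<omega> \<equiv> \<forall>n\<in>{1..N}. play \<omega> n = g n"

abbreviation histories :: "nat \<Rightarrow> (nat \<Rightarrow> move \<times> move) set" where
  "histories N \<equiv> PiE {1..N} (\<lambda>_. UNIV)"

lemma finite_histories: "finite (histories N)"
  by (intro finite_PiE) (auto simp: finite_outcomes)

lemma finite_histories_where: "finite {g \<in> histories N. A g}"
  using finite_histories by (rule rev_finite_subset) auto

lemma past_is_sets: "{\<omega>\<in>space M. past_is N g \<omega>} \<in> events"
proof -
  have "{\<omega>\<in>space M. play \<omega> n = g n} \<in> events" if "n \<in> {1..N}" for n
  proof -
    have "{\<omega>\<in>space M. play \<omega> n = g n}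
        = (X n -` {fst (g n)} \<inter> space M) \<inter> (Y n -` {snd (g n)} \<inter> space M)"
      by (auto simp: prod_eq_iff)
    also have "\<dots> \<in> events"
      using X_measurable[of n] Y_measurable[of n] that
      by (intro sets.Int measurable_sets[where A = "count_space UNIV"]) auto
    finally show ?thesis .
  qed
  then show ?thesis by (intro sets.sets_Collect_finite_All) auto
qed

lemma past_event_iff_history:
  assumes "past_event N A"
  shows "A (play \<omega>) \<longleftrightarrow> (\<exists>g\<in>{g \<in> histories N. A g}. past_is N g \<omega>)"
proof -
  let ?h = "restrict (play \<omega>) {1..N}"
  have eq: "A (play \<omega>) = A g" if "past_is N g \<omega>" for g
    by (rule assms[unfolded past_event_def, rule_format]) (use that in blast)
  have h: "past_is N ?h \<omega>" "?h \<in> histories N" by auto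
  show ?thesis
  proof
    assume "A (play \<omega>)"
    then have "?h \<in> {g \<in> histories N. A g}"
      by (intro CollectI conjI h(2)) (simp only: eq[OF h(1)])
    then show "\<exists>g\<in>{g \<in> histories N. A g}. past_is N g \<omega>"
      by (rule bexI[where P = "\<lambda>g. past_is N g \<omega>", OF h(1)])
  next
    assume "\<exists>g\<in>{g \<in> histories N. A g}. past_is N g \<omega>"
    then obtain g where "A g" "past_is N g \<omega>" by (elim bexE CollectE conjE)
    then show "A (play \<omega>)" using eq[of g] by (simp only: simp_thms)
  qed
qed

lemma past_event_sets:
  assumes "past_event N A"
  shows "{\<omega>\<in>space M. A (play \<omega>)} \<in> events"
  unfolding past_event_iff_history[OF assms]
  by (intro sets.sets_Collect_finite_Ex past_is_sets finite_histories_where)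

lemma move_sets:
  assumes "W \<in> measurable M (count_space UNIV)"
  shows "{\<omega>\<in>space M. W \<omega> = (z::move)} \<in> events"
proof -
  have "{\<omega>\<in>space M. W \<omega> = z} = W -` {z} \<inter> space M" by auto
  also have "\<dots> \<in> events" using assms by (rule measurable_sets) simp
  finally show ?thesis .
qed

text \<open>The events \<open>past_is N g\<close>, with \<open>g\<close> running over the extensional functions on
\<open>{1..N}\<close>, form a finite partition of the sample space. Probabilities given the past can
therefore be handled by finite sums instead of conditional expectations.\<close>

lemma prob_past_event_conj:
  assumes A: "past_event N A" and E: "{\<omega>\<in>space M. E \<omega>} \<in> events"
  shows "\<P>(\<omega> in M. A (play \<omega>) \<and> E \<omega>)
    = (\<Sum>g\<in>{g \<in> histories N. A g}. \<P>(\<omega> in M. past_is N g \<omega> \<and> E \<omega>))"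
proof (rule prob_sum)
  show "finite {g \<in> histories N. A g}" by (rule finite_histories_where)
  show "{\<omega>\<in>space M. past_is N g \<omega> \<and> E \<omega>} \<in> events" for g
    by (intro sets.sets_Collect_conj past_is_sets E)
  show "{\<omega>\<in>space M. A (play \<omega>) \<and> E \<omega>} \<in> events"
    by (intro sets.sets_Collect_conj past_event_sets[OF A] E)
  have uniq: "g = g'" if "g \<in> histories N" "g' \<in> histories N" "past_is N g \<omega>" "past_is N g' \<omega>" for g g' \<omega>
    using that by (intro PiE_ext[of g "{1..N}" _ g']) auto
  show "AE \<omega> in M. (\<forall>g\<in>{g \<in> histories N. A g}. past_is N g \<omega> \<and> E \<omega> \<longrightarrow> A (play \<omega>) \<and> E \<omega>) \<and>
     (A (play \<omega>) \<and> E \<omega> \<longrightarrow> (\<exists>!g\<in>{g \<in> histories N. A g}. past_is N g \<omega> \<and> E \<omega>))"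
  proof (intro AE_I2 conjI)
    fix \<omega>
    show "\<forall>g\<in>{g \<in> histories N. A g}. past_is N g \<omega> \<and> E \<omega> \<longrightarrow> A (play \<omega>) \<and> E \<omega>"
      using past_event_iff_history[OF A, of \<omega>] by blast
    show "A (play \<omega>) \<and> E \<omega> \<longrightarrow> (\<exists>!g\<in>{g \<in> histories N. A g}. past_is N g \<omega> \<and> E \<omega>)"
    proof
      assume "A (play \<omega>) \<and> E \<omega>"
      then obtain g where "g \<in> histories N" "A g" "past_is N g \<omega>" "E \<omega>"
        using past_event_iff_history[OF A, of \<omega>] by blast
      then show "\<exists>!g\<in>{g \<in> histories N. A g}. past_is N g \<omega> \<and> E \<omega>"
        using uniq[of g _ \<omega>] by (intro ex1I[of _ g]) blast+
    qed
  qed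
qed

text \<open>The plan \<open>f\<close> determines the probability of cooperation on each cell of the partition
into histories. Histories of probability zero, about which the plan says nothing, contribute zero
to both sides.\<close>

lemma prob_coop_and_past:
  assumes A: "past_event N A"
    and Z: "Z (Suc N) \<in> measurable M (count_space UNIV)"
    and f: "coop_prob_given_past M X Y Z N f"
  shows "\<P>(\<omega> in M. A (play \<omega>) \<and> Z (Suc N) \<omega> = Coop)
    = (\<Sum>g\<in>{g \<in> histories N. A g}. f g * \<P>(\<omega> in M. past_is N g \<omega>))"
proof -
  have ZC: "{\<omega>\<in>space M. Z (Suc N) \<omega> = Coop} \<in> events"
    by (rule move_sets[OF Z])
  have "\<P>(\<omega> in M. past_is N g \<omega> \<and> Z (Suc N) \<omega> = Coop) = f g * \<P>(\<omega> in M. past_is N g \<omega>)" for g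
  proof (cases "\<P>(\<omega> in M. past_is N g \<omega>) > 0")
    case True
    then have "\<P>(\<omega> in M. Z (Suc N) \<omega> = Coop \<bar> past_is N g \<omega>) = f g"
      using f unfolding coop_prob_given_past_def by blast
    then show ?thesis using True by (simp add: cond_prob_def field_simps conj_commute)
  next
    case False
    then have 0: "\<P>(\<omega> in M. past_is N g \<omega>) = 0"
      by (simp add: zero_less_measure_iff)
    have "\<P>(\<omega> in M. past_is N g \<omega> \<and> Z (Suc N) \<omega> = Coop) \<le> \<P>(\<omega> in M. past_is N g \<omega>)"
      by (intro finite_measure_mono past_is_sets) auto
    then show ?thesis using 0 by (simp add: measure_le_0_iff)
  qed
  then show ?thesis using prob_past_event_conj[OF A ZC] by simp
qed

lemma prob_past_event:
  assumes "past_event N A"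
  shows "\<P>(\<omega> in M. A (play \<omega>)) = (\<Sum>g\<in>{g \<in> histories N. A g}. \<P>(\<omega> in M. past_is N g \<omega>))"
  using prob_past_event_conj[OF assms, of "\<lambda>_. True"] by simp

lemma prob_coop_and_past_ge:
  assumes "past_event N A" "Z (Suc N) \<in> measurable M (count_space UNIV)"
    "coop_prob_given_past M X Y Z N f" and "\<And>g. A g \<Longrightarrow> p \<le> f g"
  shows "p * \<P>(\<omega> in M. A (play \<omega>)) \<le> \<P>(\<omega> in M. A (play \<omega>) \<and> Z (Suc N) \<omega> = Coop)"
  unfolding prob_coop_and_past[OF assms(1-3)] prob_past_event[OF assms(1)] sum_distrib_left
  using assms(4) by (intro sum_mono mult_right_mono) auto

lemma past_and_move_sets:
  assumes "past_event N A" and "Z (Suc N) \<in> measurable M (count_space UNIV)"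
  shows "{\<omega>\<in>space M. A (play \<omega>) \<and> Z (Suc N) \<omega> = (z::move)} \<in> events"
  using past_event_sets[OF assms(1)] move_sets[OF assms(2), of z]
  by (rule sets.sets_Collect_conj[rotated])

lemma AE_coop:
  assumes A: "past_event N A" and Z: "Z (Suc N) \<in> measurable M (count_space UNIV)"
    and f: "coop_prob_given_past M X Y Z N f" "\<And>g. A g \<Longrightarrow> f g = 1"
  shows "AE \<omega> in M. A (play \<omega>) \<longrightarrow> Z (Suc N) \<omega> = Coop"
proof -
  let ?A = "{\<omega>\<in>space M. A (play \<omega>)}" and ?B = "{\<omega>\<in>space M. A (play \<omega>) \<and> Z (Suc N) \<omega> = Coop}"
  have sets: "?A \<in> events" "?B \<in> events"
    using past_event_sets[OF A] past_and_move_sets[OF A, of Z Coop] Z by auto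
  have "prob (?A - ?B) = prob ?A - prob ?B"
    using sets by (intro finite_measure_Diff) auto
  also have "\<dots> \<le> 0"
    using prob_coop_and_past_ge[OF A Z f(1), of 1] f(2) by simp
  finally have "AE \<omega> in M. \<omega> \<notin> ?A - ?B"
    using sets by (intro AE_not_in) (auto simp: null_sets_def emeasure_eq_measure measure_le_0_iff)
  then show ?thesis by (rule AE_mp) (auto intro!: AE_I2)
qed

lemma AE_defect:
  assumes A: "past_event N A" and Z: "Z (Suc N) \<in> measurable M (count_space UNIV)"
    and f: "coop_prob_given_past M X Y Z N f" "\<And>g. A g \<Longrightarrow> f g = 0"
  shows "AE \<omega> in M. A (play \<omega>) \<longrightarrow> Z (Suc N) \<omega> = Defect"
proof -
  let ?B = "{\<omega>\<in>space M. A (play \<omega>) \<and> Z (Suc N) \<omega> = Coop}"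
  have "prob ?B = 0"
    using prob_coop_and_past[OF A Z f(1)] f(2) by simp
  then have "AE \<omega> in M. \<omega> \<notin> ?B"
    using past_and_move_sets[OF A, of Z Coop] Z
    by (intro AE_not_in) (auto simp: null_sets_def emeasure_eq_measure)
  then show ?thesis
    by (rule AE_mp) (auto intro!: AE_I2 intro: move.exhaust)
qed

section \<open>Conditional Borel-Cantelli\<close>

text \<open>Consider the opportunities \<open>A k\<close> with \<open>m \<le> k\<close> before which no opportunity
since round \<open>m\<close> has succeeded. At most one of them succeeds, so the success
events are disjoint and their probabilities have a sum of at most 1. As each such opportunity
succeeds with conditional probability at least \<open>p\<close>, the probabilities of the
opportunities themselves have a sum of at most \<open>1 / p\<close>, and the first Borel-Cantelli lemma
applies.\<close>

lemma AE_finitely_many_before_success: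
  assumes A: "\<And>k. k \<ge> 1 \<Longrightarrow> past_event k (A k)"
    and f: "\<And>k. k \<ge> 1 \<Longrightarrow> coop_prob_given_past M X Y Y k (f k)"
    and p: "p > 0" "\<And>k g. k \<ge> 1 \<Longrightarrow> A k g \<Longrightarrow> p \<le> f k g"
    and "m \<ge> 1"
  shows "AE \<omega> in M. \<forall>\<^sub>F k in sequentially.
    \<not> (A k (play \<omega>) \<and> (\<forall>j\<in>{m..<k}. \<not> (A j (play \<omega>) \<and> Y (Suc j) \<omega> = Coop)))"
proof -
  define B where "B k g \<longleftrightarrow> m \<le> k \<and> A k g \<and> (\<forall>j\<in>{m..<k}. \<not> (A j g \<and> snd (g (Suc j)) = Coop))"
    for k and g :: "nat \<Rightarrow> move \<times> move"
  have B: "past_event k (B k)" for k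
    unfolding past_event_def
  proof (intro allI impI)
    fix g g' :: "nat \<Rightarrow> move \<times> move" assume eq: "\<forall>n\<in>{1..k}. g n = g' n"
    have "A j g = A j g'" if "m \<le> j" "j \<le> k" for j
      using A[of j] eq that \<open>m \<ge> 1\<close> unfolding past_event_def by auto
    moreover have "g (Suc j) = g' (Suc j)" if "j < k" for j
      using eq that by simp
    ultimately show "B k g = B k g'" unfolding B_def by auto
  qed
  define E where "E k = {\<omega>\<in>space M. B k (play \<omega>) \<and> Y (Suc k) \<omega> = Coop}" for k
  have E: "E k \<in> events" for k
    unfolding E_def using past_and_move_sets[OF B, of Y] Y_measurable by simp
  have "disjoint_family E"
  proof -
    have "E j \<inter> E k = {}" if "j < k" for j k
      using that unfolding E_def B_def by auto
    then show ?thesis unfolding disjoint_family_on_def by (metis inf_commute nat_neq_iff)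
  qed
  then have "summable (\<lambda>k. prob (E k))"
    using E by (intro sums_summable[OF finite_measure_UNION]) auto
  then have "summable (\<lambda>k. prob (E k) / p)"
    by (rule summable_divide)
  moreover have "norm (\<P>(\<omega> in M. B k (play \<omega>))) \<le> prob (E k) / p" for k
  proof (cases "m \<le> k")
    case True
    then have "p * \<P>(\<omega> in M. B k (play \<omega>)) \<le> prob (E k)"
      unfolding E_def using \<open>m \<ge> 1\<close> p Y_measurable f
      by (intro prob_coop_and_past_ge[where f = "f k"] B) (auto simp: B_def)
    then show ?thesis using p by (simp add: field_simps)
  next
    case False
    then show ?thesis using p by (simp add: B_def)
  qed
  ultimately have "summable (\<lambda>k. \<P>(\<omega> in M. B k (play \<omega>)))"
    by (rule summable_comparison_test'[where N = 0])
  then have "AE \<omega> in M. \<forall>\<^sub>F k in sequentially. \<omega> \<in> space M - {\<omega>\<in>space M. B k (play \<omega>)}"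
    by (rule borel_cantelli_AE1[rotated 2]) (simp_all add: past_event_sets[OF B] emeasure_eq_measure)
  then show ?thesis
  proof (rule AE_mp, intro AE_I2 impI)
    fix \<omega> assume "\<forall>\<^sub>F k in sequentially. \<omega> \<in> space M - {\<omega>\<in>space M. B k (play \<omega>)}"
    then show "\<forall>\<^sub>F k in sequentially. \<not> (A k (play \<omega>) \<and>
        (\<forall>j\<in>{m..<k}. \<not> (A j (play \<omega>) \<and> Y (Suc j) \<omega> = Coop)))"
      using eventually_ge_at_top[of m] by eventually_elim (auto simp: B_def)
  qed
qed

text \<open>If successes stopped after some round \<open>m\<close>, then every later opportunity would be one
without an earlier success since \<open>m\<close>, and there are only finitely many of those.\<close>

lemma AE_infinitely_many_successes:
  assumes "\<And>k. k \<ge> 1 \<Longrightarrow> past_event k (A k)"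
    and "\<And>k. k \<ge> 1 \<Longrightarrow> coop_prob_given_past M X Y Y k (f k)"
    and "p > 0" "\<And>k g. k \<ge> 1 \<Longrightarrow> A k g \<Longrightarrow> p \<le> f k g"
  shows "AE \<omega> in M. (\<exists>\<^sub>\<infinity>k. A k (play \<omega>)) \<longrightarrow> (\<exists>\<^sub>\<infinity>k. A k (play \<omega>) \<and> Y (Suc k) \<omega> = Coop)"
proof -
  have "AE \<omega> in M. \<forall>m. \<forall>\<^sub>F k in sequentially.
      \<not> (A k (play \<omega>) \<and> (\<forall>j\<in>{Suc m..<k}. \<not> (A j (play \<omega>) \<and> Y (Suc j) \<omega> = Coop)))"
    unfolding AE_all_countable
    \<comment> \<open>\<open>Suc m\<close> in place of \<open>m\<close> because rounds start at 1.\<close>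
    by (intro allI AE_finitely_many_before_success[OF assms]) auto
  then show ?thesis
  proof (rule AE_mp, intro AE_I2 impI)
    fix \<omega>
    assume fin: "\<forall>m. \<forall>\<^sub>F k in sequentially. \<not> (A k (play \<omega>) \<and>
        (\<forall>j\<in>{Suc m..<k}. \<not> (A j (play \<omega>) \<and> Y (Suc j) \<omega> = Coop)))"
      and inf: "\<exists>\<^sub>\<infinity>k. A k (play \<omega>)"
    show "\<exists>\<^sub>\<infinity>k. A k (play \<omega>) \<and> Y (Suc k) \<omega> = Coop"
    proof (rule ccontr)
      assume "\<not> ?thesis"
      then obtain m where m: "\<And>j. j \<ge> m \<Longrightarrow> \<not> (A j (play \<omega>) \<and> Y (Suc j) \<omega> = Coop)"
        unfolding not_INFM MOST_nat_le by blast
      obtain K where K: "\<And>k. k \<ge> K \<Longrightarrow> \<not> (A k (play \<omega>) \<and>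
          (\<forall>j\<in>{Suc m..<k}. \<not> (A j (play \<omega>) \<and> Y (Suc j) \<omega> = Coop)))"
        using fin[rule_format, of m] unfolding eventually_sequentially by blast
      obtain k where "k \<ge> K" "A k (play \<omega>)" using inf unfolding INFM_nat_le by blast
      then show False using K[of k] m by auto
    qed
  qed
qed

end

section \<open>Convergence to mutual cooperation\<close>

theorem theorem3p8:
  fixes R S T P :: real
    and M :: "'w measure"
    and X Y :: "nat \<Rightarrow> 'w \<Rightarrow> move"
    and \<pi> :: "real \<times> real \<Rightarrow> real"
    and q :: "real^4"
  assumes "T > R" and "R > P" and "P > S" and "2 * R > T + S"
    and "iterated_game M X Y"
    and "convex_generous R S T P \<pi>"
    and "eventually_plays_smale R S T P M X Y \<pi>"
    and "generous_markov q"
    and "plays_markov M X Y q"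
  shows "AE \<omega> in M.
      (\<exists>N0. \<forall>n\<ge>N0. X n \<omega> = Coop \<and> Y n \<omega> = Coop) \<and>
      (\<lambda>N. avg_payoff R S T P (\<lambda>n. (X n \<omega>, Y n \<omega>)) N) \<longlonglongrightarrow> (R, R)"
proof -
  interpret iterated_game M X Y by fact
  let ?C = "coop_zone R S T P \<pi>" and ?s = "avg_payoff R S T P"
  note gen = \<open>convex_generous R S T P \<pi>\<close>
  obtain Nstar where Nstar: "Nstar \<ge> 1"
    "\<And>N. N \<ge> Nstar \<Longrightarrow> coop_prob_given_past M X Y X N (\<lambda>g. \<pi> (?s g N))"
    using \<open>eventually_plays_smale R S T P M X Y \<pi>\<close> unfolding eventually_plays_smale_def by blast
  have markov: "coop_prob_given_past M X Y Y N (\<lambda>g. markov_response q (g N))" if "N \<ge> 1" for N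
    using \<open>plays_markov M X Y q\<close> that unfolding plays_markov_def by blast
  define p where "p = min (q $ 2) (q $ 4)"
  have p: "p > 0" using \<open>generous_markov q\<close> by (simp add: p_def generous_markov_def)
  \<comment> \<open>After a defection of X, the components 2 and 4 of \<open>q\<close> are the only ones consulted.\<close>
  have p_le: "p \<le> markov_response q z" if "fst z = Defect" for z
    using that by (cases z; cases "snd z") (auto simp: p_def)
  have zone_event: "past_event N (\<lambda>g. ?s g N \<in> ?C)" for N
    unfolding past_event_def by (metis avg_payoff_cong)
  have X: "AE \<omega> in M. \<forall>n. n \<ge> Nstar \<longrightarrow> (X (Suc n) \<omega> = Coop \<longleftrightarrow> ?s (play \<omega>) n \<in> ?C)"
    unfolding AE_all_countable
  proof (intro allI)
    fix n
    show "AE \<omega> in M. n \<ge> Nstar \<longrightarrow> (X (Suc n) \<omega> = Coop \<longleftrightarrow> ?s (play \<omega>) n \<in> ?C)"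
    proof (cases "n \<ge> Nstar")
      case True
      have "AE \<omega> in M. ?s (play \<omega>) n \<in> ?C \<longrightarrow> X (Suc n) \<omega> = Coop"
        by (rule AE_coop[OF zone_event _ Nstar(2)[OF True]])
          (auto simp: coop_zone_def intro: X_measurable)
      moreover have "AE \<omega> in M. \<not> ?s (play \<omega>) n \<in> ?C \<longrightarrow> X (Suc n) \<omega> = Defect"
      proof (rule AE_defect[OF _ _ Nstar(2)[OF True]])
        show "past_event n (\<lambda>g. \<not> ?s g n \<in> ?C)"
          using zone_event[of n] unfolding past_event_def by blast
        show "\<pi> (?s g n) = 0" if "\<not> ?s g n \<in> ?C" for g
          using gen that avg_payoff_in_region[of n R S T P g] True Nstar(1)
          unfolding convex_generous_def coop_zone_def by auto
      qed (simp add: X_measurable)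
      ultimately show ?thesis by eventually_elim auto
    qed simp
  qed
  have Y: "AE \<omega> in M. \<forall>n. n \<ge> 1 \<longrightarrow> play \<omega> n = (Coop, Coop) \<longrightarrow> Y (Suc n) \<omega> = Coop"
    unfolding AE_all_countable
  proof (intro allI)
    fix n
    show "AE \<omega> in M. n \<ge> 1 \<longrightarrow> play \<omega> n = (Coop, Coop) \<longrightarrow> Y (Suc n) \<omega> = Coop"
    proof (cases "n \<ge> 1")
      case True
      have "AE \<omega> in M. play \<omega> n = (Coop, Coop) \<longrightarrow> Y (Suc n) \<omega> = Coop"
        using True \<open>generous_markov q\<close>
        by (intro AE_coop[OF _ _ markov[OF True], where A = "\<lambda>g. g n = (Coop, Coop)"])
          (auto simp: past_event_def generous_markov_def intro: Y_measurable)
      then show ?thesis by eventually_elim auto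
    qed simp
  qed
  have inf_D: "AE \<omega> in M. (\<exists>\<^sub>\<infinity>k. fst (play \<omega> k) = Defect) \<longrightarrow>
      (\<exists>\<^sub>\<infinity>k. fst (play \<omega> k) = Defect \<and> Y (Suc k) \<omega> = Coop)"
    by (rule AE_infinitely_many_successes[where A = "\<lambda>k g. fst (g k) = Defect"
        and f = "\<lambda>k g. markov_response q (g k)" and p = p])
      (auto simp: past_event_def p p_le intro: markov)
  have inf_switch: "AE \<omega> in M. (\<exists>\<^sub>\<infinity>k. fst (play \<omega> k) = Defect \<and> ?s (play \<omega>) k \<in> ?C) \<longrightarrow>
      (\<exists>\<^sub>\<infinity>k. (fst (play \<omega> k) = Defect \<and> ?s (play \<omega>) k \<in> ?C) \<and> Y (Suc k) \<omega> = Coop)"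
  proof (rule AE_infinitely_many_successes[where A = "\<lambda>k g. fst (g k) = Defect \<and> ?s g k \<in> ?C"
        and f = "\<lambda>k g. markov_response q (g k)" and p = p])
    fix k :: nat assume "k \<ge> 1"
    then show "past_event k (\<lambda>g. fst (g k) = Defect \<and> ?s g k \<in> ?C)"
      using zone_event[of k] unfolding past_event_def by auto
  qed (auto simp: p p_le intro: markov)
  from X Y inf_D inf_switch show ?thesis
  proof eventually_elim
    case (elim \<omega>)
    have "\<exists>N. \<forall>n\<ge>N. play \<omega> n = (Coop, Coop)"
      using elim Nstar(1)
      by (intro eventual_mutual_cooperation[OF gen, of Nstar]) auto
    then obtain N where N: "\<And>n. n \<ge> N \<Longrightarrow> play \<omega> n = (Coop, Coop)" by blast
    then have "?s (play \<omega>) \<longlonglongrightarrow> (R, R)"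
      using avg_payoff_eventually_const[of N "play \<omega>"] by fastforce
    then show ?case using N by auto
  qed
qed

end
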